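(* Let $d$ be a design on $N$ units with support $\mathcal{W}$ such that: (i) $\sum_{i=1}^N W_i = N/2$ with probability one and $\pi_i = \Pr_d(W_i=1)$ is the same for all $i\in\{1,\dots,N\}$; and (ii) (substitution condition) every $\bm{w}\in\mathcal{W}$ has at least one substitute in $\mathcal{W}$. For each $\bm{w}\in\mathcal{W}$ let $\mathcal{G}(\bm{w})$ be an arbitrary nonempty set of substitutes of $\bm{w}$, and define $$\hat V_{\text{sub}} = \frac{4}{N^2}\sum_{\bm{w}\in\mathcal{W}:\ \bm{W}\in\mathcal{G}(\bm{w})}\frac{p_{\bm{w}}}{p_{\bm{W}}}\,\frac{1}{|\mathcal{G}(\bm{w})|}\,\{\bm{l}(\bm{w})^\top\bm{Y}^{\text{obs}}\}^2 .$$ Then: (a) Under treatment effect homogeneity, i.e. $Y_i(1)-Y_i(0)=\tau$ for all $i$, one has $\mathbb{E}_d(\hat V_{\text{sub}})=\mathrm{Var}_d(\hat\tau)$. (b) If moreover $\bm{w}\in\mathcal{W}\iff \bm{1}-\bm{w}\in\mathcal{W}$, and for every $\bm{w}\in\mathcal{W}$ the set $\mathcal{G}(\bm{w})$ is closed under label switching (i.e. $\tilde{\bm{w}}\in\mathcal{G}(\bm{w})\iff\bm{1}-\tilde{\bm{w}}\in\mathcal{G}(\bm{w})$), then $\mathbb{E}_d(\hat V_{\text{sub}})\ge \mathrm{Var}_d(\hat\tau)$ for all values of the potential outcomes (homogeneity is not assumed). (c) $\hat V_{\text{sub}}\ge 0$.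
   Context: There are $N$ units, $i=1,\dots,N$, with fixed (non-random) real potential outcomes $Y_i(0),Y_i(1)$. A design $d$ is a probability distribution of the random assignment vector $\bm{W}=(W_1,\dots,W_N)^\top\in\{0,1\}^N$; write $p_{\bm{w}}=\Pr_d(\bm{W}=\bm{w})$, $\mathcal{W}=\{\bm{w}:p_{\bm{w}}>0\}$ (the support) and $\pi_i=\Pr_d(W_i=1)$. $\mathbb{E}_d,\mathrm{Var}_d$ are with respect to $\bm{W}$ only. The observed outcome is $Y_i^{\text{obs}}=W_iY_i(1)+(1-W_i)Y_i(0)$ and $\bm{Y}^{\text{obs}}=(Y_1^{\text{obs}},\dots,Y_N^{\text{obs}})^\top$. The average treatment effect is $\tau=\frac1N\sum_{i=1}^N\{Y_i(1)-Y_i(0)\}$, and the Horvitz–Thompson estimator is $\hat\tau=\frac1N\sum_i W_iY_i^{\text{obs}}/\pi_i-\frac1N\sum_i(1-W_i)Y_i^{\text{obs}}/(1-\pi_i)$. $N$ is divisible by 4. For $\bm{w}\in\mathcal{W}$ (which treats exactly $N/2$ units), a substitute of $\bm{w}$ is a vector $\tilde{\bm{w}}\in\mathcal{W}$ whose set of treated units $\{i:\tilde w_i=1\}$ consists of exactly $N/4$ of the units treated under $\bm{w}$ and exactly $N/4$ of the units that are control under $\bm{w}$. The vector $\bm{l}(\bm{w})=(l_1(\bm{w}),\dots,l_N(\bm{w}))^\top$ has $l_i(\bm{w})=1$ if $w_i=1$ and $l_i(\bm{w})=-1$ if $w_i=0$. $\bm{1}$ is the all-ones vector. *)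

theory Defs
  imports "HOL-Probability.Probability"
begin

text \<open>
  The units are the elements of a finite type \<open>'n\<close>, so \<open>N = CARD('n)\<close>. An assignment vector
  in \<open>{0,1}^N\<close> is a \<open>bool ^ 'n\<close> (true = treated), read as a number through \<open>of_bool\<close>.
  A design is a pmf \<open>d\<close> on assignment vectors; its support is \<open>set_pmf d\<close> and
  \<open>p_w\<close> is \<open>pmf d w\<close>.
\<close>

type_synonym 'n assignment = "bool ^ 'n"

definition treated :: "'n::finite assignment \<Rightarrow> 'n set" where
  "treated w = {i. w $ i}"

definition control :: "'n::finite assignment \<Rightarrow> 'n set" where
  "control w = {i. \<not> w $ i}"

text \<open>The vector \<open>1 - w\<close>.\<close>

definition switch_labels :: "'n::finite assignment \<Rightarrow> 'n assignment" where
  "switch_labels w = (\<chi> i. \<not> w $ i)"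

definition treatment_prob :: "'n::finite assignment pmf \<Rightarrow> 'n \<Rightarrow> real" where
  "treatment_prob d i = measure_pmf.prob d {w. w $ i}"

text \<open>Below, \<open>Y0\<close> and \<open>Y1\<close> are the vectors of potential outcomes under control and treatment.\<close>

definition observed :: "real ^ 'n::finite \<Rightarrow> real ^ 'n \<Rightarrow> 'n assignment \<Rightarrow> real ^ 'n" where
  "observed Y0 Y1 w = (\<chi> i. of_bool (w $ i) * Y1 $ i + (1 - of_bool (w $ i)) * Y0 $ i)"

definition average_effect :: "real ^ 'n::finite \<Rightarrow> real ^ 'n \<Rightarrow> real" where
  "average_effect Y0 Y1 = (1 / real CARD('n)) * (\<Sum>i\<in>UNIV. Y1 $ i - Y0 $ i)"

definition homogeneous_effect :: "real ^ 'n::finite \<Rightarrow> real ^ 'n \<Rightarrow> bool" where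
  "homogeneous_effect Y0 Y1 \<longleftrightarrow> (\<forall>i. Y1 $ i - Y0 $ i = average_effect Y0 Y1)"

text \<open>
  Estimators are functions of the realised assignment \<open>W\<close> and the observed outcome vector \<open>y\<close>.
\<close>

definition horvitz_thompson ::
    "'n::finite assignment pmf \<Rightarrow> 'n assignment \<Rightarrow> real ^ 'n \<Rightarrow> real" where
  "horvitz_thompson d W y =
     (1 / real CARD('n)) * (\<Sum>i\<in>UNIV. of_bool (W $ i) * y $ i / treatment_prob d i)
   - (1 / real CARD('n)) * (\<Sum>i\<in>UNIV. (1 - of_bool (W $ i)) * y $ i / (1 - treatment_prob d i))"

text \<open>
  The natural-number division below is only used when \<open>4\<close> divides \<open>CARD('n)\<close>.
\<close>

definition is_substitute ::
    "'n::finite assignment pmf \<Rightarrow> 'n assignment \<Rightarrow> 'n assignment \<Rightarrow> bool" where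
  "is_substitute d w w' \<longleftrightarrow>
     w' \<in> set_pmf d \<and>
     card (treated w' \<inter> treated w) = CARD('n) div 4 \<and>
     card (treated w' \<inter> control w) = CARD('n) div 4"

definition label_vec :: "'n::finite assignment \<Rightarrow> real ^ 'n" where
  "label_vec w = (\<chi> i. if w $ i then 1 else -1)"

definition V_sub ::
    "'n::finite assignment pmf \<Rightarrow> ('n assignment \<Rightarrow> 'n assignment set) \<Rightarrow>
     'n assignment \<Rightarrow> real ^ 'n \<Rightarrow> real" where
  "V_sub d G W y =
     (4 / (real CARD('n))\<^sup>2) *
     (\<Sum>w | w \<in> set_pmf d \<and> W \<in> G w.
        pmf d w / pmf d W * (1 / real (card (G w))) * (label_vec w \<bullet> y)\<^sup>2)"

end

theory Submission
  imports Defs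
begin

text \<open>
  Under the design every unit is treated with probability \<open>1/2\<close>. Writing \<open>s = Y0 + Y1\<close>,
  \<open>\<delta> = Y1 - Y0\<close> and \<open>l\<close> for the label vector, the Horvitz-Thompson estimator is
  \<open>\<tau> + (l(W) \<bullet> s) / N\<close>, so its variance is the mean of \<open>(l(w) \<bullet> s)\<^sup>2 / N\<^sup>2\<close>.
  Exchanging the order of summation, the mean of \<open>V_sub\<close> is that of
  \<open>(l(w) \<bullet> s + B)\<^sup>2 / N\<^sup>2\<close>, averaged over the substitutes \<open>W\<close> of \<open>w\<close> in \<open>G w\<close>,
  where \<open>B = \<Sum>i. l\<^sub>i(w) l\<^sub>i(W) \<delta>\<^sub>i\<close>. If \<open>\<delta>\<close> is constant, \<open>B\<close> vanishes because label vectors of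
  substitutes are orthogonal. If \<open>G w\<close> is closed under label switching, \<open>B\<close> averages to zero
  over \<open>G w\<close>, so the average exceeds the variance term by the mean of \<open>B\<^sup>2 / N\<^sup>2\<close>.
\<close>

lemma label_vec_eq: "label_vec w $ i = 2 * of_bool (w $ i) - 1"
  by (simp add: label_vec_def)

lemma label_vec_switch_labels: "label_vec (switch_labels w) = - label_vec w"
  by (simp add: label_vec_def switch_labels_def vec_eq_iff)

lemma switch_labels_involutive [simp]: "switch_labels (switch_labels w) = w"
  by (simp add: switch_labels_def vec_eq_iff)

lemma expectation_assignment:
  fixes f :: "'n::finite assignment \<Rightarrow> real"
  shows "measure_pmf.expectation d f = (\<Sum>w\<in>set_pmf d. pmf d w * f w)"
  by (subst integral_measure_pmf_real[of "set_pmf d"]) (auto simp: mult.commute)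

lemma sum_pmf_set_pmf: "(\<Sum>w\<in>set_pmf d. pmf d w) = 1" for d :: "'n::finite assignment pmf"
  by (rule sum_pmf_eq_1) auto

lemma treatment_prob_eq_sum:
  "treatment_prob d i = (\<Sum>w\<in>set_pmf d. pmf d w * of_bool (w $ i))"
proof -
  have "treatment_prob d i = measure_pmf.expectation d (indicator {w. w $ i})"
    by (simp add: treatment_prob_def)
  also have "\<dots> = (\<Sum>w\<in>set_pmf d. pmf d w * of_bool (w $ i))"
    unfolding expectation_assignment by (intro sum.cong) (auto simp: indicator_def)
  finally show ?thesis .
qed

text \<open>Counting treated units in expectation: the \<open>N\<close> equal probabilities add up
  to the mean number of treated units, which is \<open>N / 2\<close>.\<close>

lemma treatment_prob_eq_half:
  fixes d :: "'n::finite assignment pmf"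
  assumes balanced: "\<And>w. w \<in> set_pmf d \<Longrightarrow> (\<Sum>i\<in>UNIV. of_bool (w $ i)) = real CARD('n) / 2"
    and equal: "\<And>i j. treatment_prob d i = treatment_prob d j"
  shows "treatment_prob d i = 1 / 2"
proof -
  have "real CARD('n) * treatment_prob d i = (\<Sum>j\<in>(UNIV :: 'n set). treatment_prob d i)"
    by simp
  also have "\<dots> = (\<Sum>j\<in>UNIV. treatment_prob d j)"
    by (intro sum.cong refl equal)
  also have "\<dots> = (\<Sum>w\<in>set_pmf d. pmf d w * (\<Sum>j\<in>UNIV. of_bool (w $ j)))"
    unfolding treatment_prob_eq_sum sum_distrib_left by (rule sum.swap)
  also have "\<dots> = (\<Sum>w\<in>set_pmf d. pmf d w) * (real CARD('n) / 2)"
    unfolding sum_distrib_right by (intro sum.cong refl) (simp only: balanced)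
  finally show ?thesis
    by (simp add: sum_pmf_set_pmf field_simps)
qed

lemma observed_eq:
  "observed Y0 Y1 w $ i = ((Y0 + Y1) $ i + label_vec w $ i * (Y1 - Y0) $ i) / 2"
  by (simp add: observed_def label_vec_def)

text \<open>Here \<open>w\<close> supplies the labels and \<open>W\<close> the realised outcomes.
  The factor 2 clears the half in \<open>observed_eq\<close>, and only the effect part depends on
  \<open>W\<close>.\<close>

lemma inner_label_vec_observed:
  "2 * (label_vec w \<bullet> observed Y0 Y1 W) =
     label_vec w \<bullet> (Y0 + Y1) + (\<Sum>i\<in>UNIV. label_vec w $ i * label_vec W $ i * (Y1 - Y0) $ i)"
  unfolding inner_vec_def observed_eq sum_distrib_left sum.distrib[symmetric]
  by (intro sum.cong refl) (simp add: distrib_left)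

text \<open>At probability \<open>1 / 2\<close> the estimator is
  \<open>2 * (label_vec W \<bullet> y) / N\<close>. In the decomposition with \<open>w = W\<close>
  squared labels are 1, so the effect part sums to \<open>N\<close> times the average
  effect.\<close>

lemma horvitz_thompson_observed:
  fixes d :: "'n::finite assignment pmf"
  assumes half: "\<And>i. treatment_prob d i = 1 / 2"
  shows "horvitz_thompson d W (observed Y0 Y1 W) =
     average_effect Y0 Y1 + label_vec W \<bullet> (Y0 + Y1) / real CARD('n)"
proof -
  have "2 * (label_vec W \<bullet> observed Y0 Y1 W) =
      label_vec W \<bullet> (Y0 + Y1) + (\<Sum>i\<in>UNIV. Y1 $ i - Y0 $ i)"
    unfolding inner_label_vec_observed
    by (intro arg_cong2[of _ _ _ _ "(+)"] sum.cong)
      (auto simp: label_vec_def)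
  moreover have "horvitz_thompson d W y = 2 * (label_vec W \<bullet> y) / real CARD('n)" for y
    unfolding horvitz_thompson_def half inner_vec_def sum_distrib_left sum_divide_distrib
      sum_subtractf[symmetric]
    by (intro sum.cong refl) (simp add: label_vec_def)
  ultimately show ?thesis
    by (simp add: average_effect_def add_divide_distrib)
qed

text \<open>Each label has mean \<open>2 * treatment_prob d i - 1 = 0\<close>. This is what makes
  the Horvitz-Thompson estimator unbiased.\<close>

lemma expectation_label_vec_inner:
  assumes half: "\<And>i. treatment_prob d i = 1 / 2"
  shows "(\<Sum>w\<in>set_pmf d. pmf d w * (label_vec w \<bullet> s)) = 0"
proof -
  have "(\<Sum>w\<in>set_pmf d. pmf d w * label_vec w $ i) = 2 * treatment_prob d i - 1" for i
    unfolding treatment_prob_eq_sum label_vec_eq right_diff_distrib sum_subtractf sum_distrib_left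
    by (simp add: sum_pmf_set_pmf mult.left_commute)
  then have mean: "(\<Sum>w\<in>set_pmf d. pmf d w * label_vec w $ i) = 0" for i
    by (simp add: half)
  have "(\<Sum>w\<in>set_pmf d. pmf d w * (label_vec w \<bullet> s)) =
      (\<Sum>i\<in>UNIV. \<Sum>w\<in>set_pmf d. pmf d w * (label_vec w $ i * s $ i))"
    unfolding inner_vec_def sum_distrib_left inner_real_def by (rule sum.swap)
  also have "\<dots> = (\<Sum>i\<in>UNIV. (\<Sum>w\<in>set_pmf d. pmf d w * label_vec w $ i) * s $ i)"
    by (simp add: sum_distrib_right mult.assoc)
  finally show ?thesis by (simp add: mean)
qed

lemma variance_horvitz_thompson:
  fixes d :: "'n::finite assignment pmf"
  assumes half: "\<And>i. treatment_prob d i = 1 / 2"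
  shows "measure_pmf.variance d (\<lambda>W. horvitz_thompson d W (observed Y0 Y1 W)) =
     (\<Sum>w\<in>set_pmf d. pmf d w * (label_vec w \<bullet> (Y0 + Y1))\<^sup>2) / (real CARD('n))\<^sup>2"
proof -
  let ?N = "real CARD('n)"
  have "measure_pmf.expectation d (\<lambda>W. horvitz_thompson d W (observed Y0 Y1 W)) =
      (\<Sum>w\<in>set_pmf d. pmf d w) * average_effect Y0 Y1
      + (\<Sum>w\<in>set_pmf d. pmf d w * (label_vec w \<bullet> (Y0 + Y1))) / ?N"
    unfolding horvitz_thompson_observed[OF half] expectation_assignment
    by (simp only: distrib_left sum.distrib sum_distrib_right sum_divide_distrib times_divide_eq_right)
  then have "measure_pmf.expectation d (\<lambda>W. horvitz_thompson d W (observed Y0 Y1 W)) =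
      average_effect Y0 Y1"
    by (simp only: expectation_label_vec_inner[OF half] sum_pmf_set_pmf mult_1_left div_0 add_0_right)
  then show ?thesis
    unfolding horvitz_thompson_observed[OF half]
    by (simp only: expectation_assignment add_diff_cancel_left' power_divide
        sum_divide_distrib times_divide_eq_right)
qed

text \<open>The weight \<open>pmf d w / pmf d W\<close> trades the probability of the realised
  \<open>W\<close> for that of \<open>w\<close>. After the swap of sums, \<open>w\<close> is drawn
  from the design and \<open>W\<close> uniformly from \<open>G w\<close>. The constant 4 moves into
  the square.\<close>

lemma expectation_V_sub:
  fixes d :: "'n::finite assignment pmf" and y :: "'n assignment \<Rightarrow> real ^ 'n"
  assumes "\<And>w. w \<in> set_pmf d \<Longrightarrow> G w \<subseteq> set_pmf d"
  shows "measure_pmf.expectation d (\<lambda>W. V_sub d G W (y W)) =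
     (\<Sum>w\<in>set_pmf d. pmf d w *
        ((\<Sum>W\<in>G w. (2 * (label_vec w \<bullet> y W))\<^sup>2) / real (card (G w)))) / (real CARD('n))\<^sup>2"
proof -
  let ?N = "real CARD('n)"
  let ?t = "\<lambda>w W. pmf d w * ((2 * (label_vec w \<bullet> y W))\<^sup>2 / real (card (G w))) / ?N\<^sup>2"
  have "pmf d W * V_sub d G W (y W) = (\<Sum>w | w \<in> set_pmf d \<and> W \<in> G w. ?t w W)"
    if "W \<in> set_pmf d" for W
  proof -
    \<comment> \<open>The factor \<open>pmf d W\<close> of the expectation cancels against the
      denominator of the weight.\<close>
    have "pmf d W \<noteq> 0" using that by (simp add: set_pmf_iff)
    then show ?thesis
      unfolding V_sub_def sum_distrib_left
      by (intro sum.cong) (auto simp: power_mult_distrib mult_ac)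
  qed
  then have "measure_pmf.expectation d (\<lambda>W. V_sub d G W (y W)) =
      (\<Sum>W\<in>set_pmf d. \<Sum>w | w \<in> set_pmf d \<and> W \<in> G w. ?t w W)"
    by (simp add: expectation_assignment)
  also have "\<dots> = (\<Sum>w\<in>set_pmf d. \<Sum>W | W \<in> set_pmf d \<and> W \<in> G w. ?t w W)"
    by (rule sum.swap_restrict) auto
  also have "\<dots> = (\<Sum>w\<in>set_pmf d. \<Sum>W\<in>G w. ?t w W)"
    using assms by (intro sum.cong) auto
  finally show ?thesis
    by (simp add: sum_divide_distrib sum_distrib_left)
qed

text \<open>With 0/1 entries \<open>a\<close> and \<open>b\<close>, the product of labels is
  \<open>4ab - 2a - 2b + 1\<close>. Summed over the units, this gives
  \<open>N - N - N + N\<close>.\<close>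

lemma label_vec_substitute_orthogonal:
  fixes w W :: "'n::finite assignment"
  assumes "4 dvd CARD('n)"
    and "(\<Sum>i\<in>UNIV. of_bool (w $ i)) = real CARD('n) / 2"
    and "(\<Sum>i\<in>UNIV. of_bool (W $ i)) = real CARD('n) / 2"
    and "is_substitute d w W"
  shows "(\<Sum>i\<in>UNIV. label_vec w $ i * label_vec W $ i) = 0"
proof -
  have "(\<Sum>i\<in>UNIV. of_bool (w $ i \<and> W $ i)) = real (card (treated W \<inter> treated w))"
    by (simp add: treated_def Int_def conj_commute)
  also have "\<dots> = real CARD('n) / 4"
    \<comment> \<open>Divisibility by 4 makes the natural-number quotient exact.\<close>
    using assms(1,4) by (simp add: is_substitute_def real_of_nat_div)
  finally have both: "(\<Sum>i\<in>UNIV. of_bool (w $ i \<and> W $ i)) = real CARD('n) / 4" .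
  have "(\<Sum>i\<in>UNIV. label_vec w $ i * label_vec W $ i) =
      (\<Sum>i\<in>UNIV. 4 * of_bool (w $ i \<and> W $ i) - 2 * of_bool (w $ i) - 2 * of_bool (W $ i) + 1)"
    by (intro sum.cong) (auto simp: label_vec_def)
  also have "\<dots> = 4 * (\<Sum>i\<in>UNIV. of_bool (w $ i \<and> W $ i)) - 2 * (\<Sum>i\<in>UNIV. of_bool (w $ i))
      - 2 * (\<Sum>i\<in>UNIV. of_bool (W $ i)) + real CARD('n)"
    by (simp only: sum.distrib sum_subtractf sum_distrib_left sum_constant mult_1_right)
  finally show ?thesis
    unfolding both assms(2,3) by simp
qed

text \<open>The involution \<sigma> cancels the values of \<open>B\<close> over \<open>S\<close>, so
  the cross term of the expanded square vanishes and the squares of \<open>B\<close> can only add.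
  It serves part (b) with label switching as \<sigma>.\<close>

lemma square_le_mean_square_odd:
  fixes B :: "'a \<Rightarrow> real"
  assumes "finite S" "S \<noteq> {}"
    and closed: "\<And>x. x \<in> S \<Longrightarrow> \<sigma> x \<in> S" and inv: "\<And>x. \<sigma> (\<sigma> x) = x"
    and odd: "\<And>x. B (\<sigma> x) = - B x"
  shows "a\<^sup>2 \<le> (\<Sum>x\<in>S. (a + B x)\<^sup>2) / real (card S)"
proof -
  have "(\<Sum>x\<in>S. B x) = (\<Sum>x\<in>S. - B x)"
    by (rule sum.reindex_bij_witness[where i = \<sigma> and j = \<sigma>]) (auto simp: closed inv odd)
  then have zero: "(\<Sum>x\<in>S. B x) = 0"
    by (simp add: sum_negf)
  have "(\<Sum>x\<in>S. (a + B x)\<^sup>2) = (\<Sum>x\<in>S. a\<^sup>2 + 2 * a * B x + (B x)\<^sup>2)"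
    by (intro sum.cong refl) (simp add: power2_sum)
  also have "\<dots> = real (card S) * a\<^sup>2 + 2 * a * (\<Sum>x\<in>S. B x) + (\<Sum>x\<in>S. (B x)\<^sup>2)"
    by (simp add: sum.distrib sum_distrib_left)
  also have "\<dots> \<ge> real (card S) * a\<^sup>2"
    by (simp add: zero sum_nonneg)
  finally show ?thesis
    using assms(1,2) by (simp add: field_simps card_gt_0_iff)
qed

theorem theorem4p1:
  fixes d :: "'n::finite assignment pmf"
    and G :: "'n assignment \<Rightarrow> 'n assignment set"
    and Y0 Y1 :: "real ^ 'n"
  assumes "4 dvd CARD('n)"
    and "AE W in measure_pmf d. (\<Sum>i\<in>UNIV. of_bool (W $ i)) = real CARD('n) / 2"
    and "\<forall>i j. treatment_prob d i = treatment_prob d j"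
    and "\<forall>w\<in>set_pmf d. \<exists>w'. is_substitute d w w'"
    and "\<forall>w\<in>set_pmf d. G w \<noteq> {} \<and> (\<forall>w'\<in>G w. is_substitute d w w')"
  shows "(homogeneous_effect Y0 Y1 \<longrightarrow>
      measure_pmf.expectation d (\<lambda>W. V_sub d G W (observed Y0 Y1 W))
      = measure_pmf.variance d (\<lambda>W. horvitz_thompson d W (observed Y0 Y1 W)))
    \<and> ((\<forall>w. w \<in> set_pmf d \<longleftrightarrow> switch_labels w \<in> set_pmf d) \<and>
      (\<forall>w\<in>set_pmf d. \<forall>w'. w' \<in> G w \<longleftrightarrow> switch_labels w' \<in> G w) \<longrightarrow>
      measure_pmf.expectation d (\<lambda>W. V_sub d G W (observed Y0 Y1 W))
      \<ge> measure_pmf.variance d (\<lambda>W. horvitz_thompson d W (observed Y0 Y1 W)))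
    \<and> (\<forall>W\<in>set_pmf d. V_sub d G W (observed Y0 Y1 W) \<ge> 0)"
proof -
  let ?B = "\<lambda>w W. \<Sum>i\<in>UNIV. label_vec w $ i * label_vec W $ i * (Y1 - Y0) $ i"
  let ?s = "Y0 + Y1"
  have balanced: "(\<Sum>i\<in>UNIV. of_bool (w $ i)) = real CARD('n) / 2" if "w \<in> set_pmf d" for w
    using assms(2) that by (auto simp: AE_measure_pmf_iff)
  have subset: "G w \<subseteq> set_pmf d" if "w \<in> set_pmf d" for w
    using assms(5) that by (auto simp: is_substitute_def)
  have nonempty: "G w \<noteq> {}" if "w \<in> set_pmf d" for w
    using assms(5) that by auto
  have half: "treatment_prob d i = 1 / 2" for i
    by (rule treatment_prob_eq_half[OF balanced assms(3)[rule_format]])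
  note var = variance_horvitz_thompson[OF half, of Y0 Y1]
  have exp: "measure_pmf.expectation d (\<lambda>W. V_sub d G W (observed Y0 Y1 W)) =
      (\<Sum>w\<in>set_pmf d. pmf d w *
        ((\<Sum>W\<in>G w. (label_vec w \<bullet> ?s + ?B w W)\<^sup>2) / real (card (G w)))) / (real CARD('n))\<^sup>2"
    using expectation_V_sub[where G = G and y = "observed Y0 Y1", OF subset]
    unfolding inner_label_vec_observed .
  have a: "measure_pmf.expectation d (\<lambda>W. V_sub d G W (observed Y0 Y1 W))
      = measure_pmf.variance d (\<lambda>W. horvitz_thompson d W (observed Y0 Y1 W))"
    if hom: "homogeneous_effect Y0 Y1"
  proof -
    \<comment> \<open>A constant effect factors out of \<open>?B w W\<close> and leaves the inner
      product of two orthogonal label vectors.\<close>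
    have "?B w W = 0" if "w \<in> set_pmf d" "W \<in> G w" for w W
    proof -
      have "(Y1 - Y0) $ i = average_effect Y0 Y1" for i
        using hom by (simp add: homogeneous_effect_def)
      then have "?B w W = (\<Sum>i\<in>UNIV. label_vec w $ i * label_vec W $ i) * average_effect Y0 Y1"
        by (simp only: sum_distrib_right)
      also have "(\<Sum>i\<in>UNIV. label_vec w $ i * label_vec W $ i) = 0"
        using that subset assms(5)
        by (intro label_vec_substitute_orthogonal[OF assms(1)] balanced) auto
      finally show ?thesis by simp
    qed
    then have "(\<Sum>W\<in>G w. (label_vec w \<bullet> ?s + ?B w W)\<^sup>2) = (\<Sum>W\<in>G w. (label_vec w \<bullet> ?s)\<^sup>2)"
      if "w \<in> set_pmf d" for w
      using that by (intro sum.cong refl) (simp only: add_0_right)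
    then have "(\<Sum>W\<in>G w. (label_vec w \<bullet> ?s + ?B w W)\<^sup>2) / real (card (G w)) = (label_vec w \<bullet> ?s)\<^sup>2"
      if "w \<in> set_pmf d" for w
      \<comment> \<open>The terms are constant in \<open>W\<close>; nonemptiness gives a nonzero
        cardinality to cancel.\<close>
      using that nonempty by (simp only: sum_constant) simp
    then show ?thesis
      unfolding exp var by (simp only: cong: sum.cong)
  qed
  have b: "measure_pmf.expectation d (\<lambda>W. V_sub d G W (observed Y0 Y1 W))
      \<ge> measure_pmf.variance d (\<lambda>W. horvitz_thompson d W (observed Y0 Y1 W))"
    if closed: "\<forall>w\<in>set_pmf d. \<forall>w'. w' \<in> G w \<longleftrightarrow> switch_labels w' \<in> G w"
  proof -
    have "(label_vec w \<bullet> ?s)\<^sup>2 \<le> (\<Sum>W\<in>G w. (label_vec w \<bullet> ?s + ?B w W)\<^sup>2) / real (card (G w))"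
      if "w \<in> set_pmf d" for w
    \<comment> \<open>For fixed \<open>w\<close>, the term \<open>label_vec w \<bullet> ?s\<close>
      plays the constant \<open>a\<close>, and \<open>?B w\<close> is odd because switching negates
      the labels of \<open>W\<close>.\<close>
    proof (rule square_le_mean_square_odd[where \<sigma> = switch_labels])
      show "?B w (switch_labels W) = - ?B w W" for W
        unfolding label_vec_switch_labels sum_negf[symmetric] by (intro sum.cong refl) simp
      show "switch_labels W \<in> G w" if "W \<in> G w" for W
        using closed \<open>w \<in> set_pmf d\<close> that by blast
    qed (simp_all add: nonempty that)
    then show ?thesis
      unfolding exp var by (intro divide_right_mono sum_mono mult_left_mono) auto
  qed
  have c: "V_sub d G W (observed Y0 Y1 W) \<ge> 0" for W
    unfolding V_sub_def by (intro mult_nonneg_nonneg sum_nonneg) auto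
  show ?thesis
    by (rule conjI[OF impI[OF a] conjI[OF impI[OF b[OF conjunct2]] ballI[OF c]]])
qed

end
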